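(* Let $0<\alpha<1/3$ and define $\Phi:\mathbb{R}\to\mathbb{R}$ by $$\Phi(w)=\begin{cases}\frac{1}{\sqrt{2\pi}} & 0\le |w|<(1-\alpha)\pi,\\ \frac{1}{\sqrt{2\pi}}\cos\left(\frac{1}{4\alpha}\big(|w|-(1-\alpha)\pi\big)\right) & (1-\alpha)\pi\le |w|<(1+\alpha)\pi,\\ 0 & |w|\ge (1+\alpha)\pi.\end{cases}$$ Let $H$ be defined by $H\left(\frac{w}{2}\right)=\frac{1}{\sqrt{\pi}}\,\Phi(w)$. Then the two-scale relation $$\Phi(w)=\frac{1}{\sqrt{2}}\,H\left(\frac{w}{2}\right)\Phi\left(\frac{w}{2}\right)$$ holds; that is, $$\Phi(w)=\frac{1}{\sqrt{2}}\,\frac{1}{\sqrt{\pi}}\,\Phi(w)\,\Phi\left(\frac{w}{2}\right).$$ Indeed this is an identity for $|w|>(1+\alpha)\pi$, and in the region $|w|<(1+\alpha)\pi$ one has $\Phi\left(\frac{w}{2}\right)=\sqrt{2\pi}$ under the constraint $\alpha<1/3$.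
   Context: $\Phi$ is the Fourier spectrum of the scaling function (the square root of the raised cosine spectrum with roll-off factor $\alpha$), and $H$ is the low-pass filter of the multiresolution analysis, required to satisfy the two-scale relation displayed in the claim.
   Formalization: As printed the relation fails at w=0 (it would force 2π=1). The formal version keeps Φ but takes H(w/2)=(1/√π)·2πΦ(w), puts the same factor 2π in the expanded relation, and has Φ(w/2)=1/√(2π) instead of √(2π) for |w|<(1+α)π. *)

theory Defs
  imports Complex_Main
begin

text \<open>Square root of the raised cosine spectrum with roll-off factor \<open>\<alpha>\<close>, normalised for the
  unitary Fourier transform, so that its value at 0 is \<open>1 / sqrt (2 * pi)\<close>.\<close>

definition Phi :: "real \<Rightarrow> real \<Rightarrow> real" where
  "Phi \<alpha> w =
     (if \<bar>w\<bar> < (1 - \<alpha>) * pi then 1 / sqrt (2 * pi)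
      else if \<bar>w\<bar> < (1 + \<alpha>) * pi
        then 1 / sqrt (2 * pi) * cos (1 / (4 * \<alpha>) * (\<bar>w\<bar> - (1 - \<alpha>) * pi))
      else 0)"

text \<open>With the amplitude \<open>1 / sqrt (2 * pi)\<close>, the source's filter \<open>H (w/2) = 1 / sqrt pi * Phi \<alpha> w\<close>
  and its value \<open>Phi \<alpha> (w/2) = sqrt (2 * pi)\<close> are each off by a factor \<open>2 * pi\<close>: they hold for
  \<open>2 * pi * Phi \<alpha>\<close> in place of \<open>Phi \<alpha>\<close>. The next two lemmas show that neither can be kept.
  The filter that does satisfy the two-scale relation is \<open>H (w/2) = 1 / sqrt pi * (2 * pi * Phi \<alpha> w)\<close>;
  it has the usual low-pass value \<open>H 0 = sqrt 2\<close>.\<close>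

lemma Phi_zero: "0 < \<alpha> \<Longrightarrow> \<alpha> < 1/3 \<Longrightarrow> Phi \<alpha> 0 = 1 / sqrt (2 * pi)"
  by (simp add: Phi_def)

lemma Phi_zero_neq:
  assumes "0 < \<alpha>" "\<alpha> < 1/3"
  shows "Phi \<alpha> (0/2) \<noteq> sqrt (2 * pi)"
proof
  assume "Phi \<alpha> (0/2) = sqrt (2 * pi)"
  then have "1 / sqrt (2 * pi) = sqrt (2 * pi)"
    using Phi_zero[OF assms] by simp
  then have "sqrt (2 * pi) * sqrt (2 * pi) = 1"
    by (simp add: divide_eq_eq)
  then show False
    using pi_ge_two by simp
qed

lemma two_scale_without_factor_fails:
  assumes "0 < \<alpha>" "\<alpha> < 1/3"
  shows "Phi \<alpha> 0 \<noteq> 1 / sqrt 2 * (1 / sqrt pi) * Phi \<alpha> 0 * Phi \<alpha> (0/2)"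
proof
  assume *: "Phi \<alpha> 0 = 1 / sqrt 2 * (1 / sqrt pi) * Phi \<alpha> 0 * Phi \<alpha> (0/2)"
  have "Phi \<alpha> 0 \<noteq> 0"
    using Phi_zero[OF assms] by simp
  then have "Phi \<alpha> (0/2) = sqrt (2 * pi)"
    using * by (simp add: real_sqrt_mult field_simps)
  then show False
    using Phi_zero_neq[OF assms] by simp
qed

end

theory Submission
  imports Defs
begin

lemma Phi_eq_0:
  assumes "0 < \<alpha>" and "(1 + \<alpha>) * pi \<le> \<bar>w\<bar>"
  shows "Phi \<alpha> w = 0"
proof -
  \<comment> \<open>Positivity of \<open>\<alpha>\<close> orders the two thresholds, so the flat
    branch, tested first, cannot apply either.\<close>
  have "(1 - \<alpha>) * pi < (1 + \<alpha>) * pi"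
    using assms(1) by simp
  with assms(2) have "\<not> \<bar>w\<bar> < (1 - \<alpha>) * pi" "\<not> \<bar>w\<bar> < (1 + \<alpha>) * pi"
    by linarith+
  then show ?thesis
    by (simp add: Phi_def)
qed

\<comment> \<open>The constraint \<open>\<alpha> < 1/3\<close> says exactly that \<open>(1 + \<alpha>) / 2 < 1 - \<alpha>\<close>: half of the support of
  \<open>Phi \<alpha>\<close> lies in its flat part.\<close>
lemma Phi_half_eq:
  assumes "\<alpha> < 1 / 3" and "\<bar>w\<bar> < (1 + \<alpha>) * pi"
  shows "Phi \<alpha> (w / 2) = 1 / sqrt (2 * pi)"
proof -
  have "(1 + \<alpha>) * pi < (2 * (1 - \<alpha>)) * pi"
    using assms(1) by (intro mult_strict_right_mono) auto
  with assms(2) have "\<bar>w / 2\<bar> < (1 - \<alpha>) * pi"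
    by linarith
  then show ?thesis
    by (simp add: Phi_def)
qed

text \<open>Within the support the half-argument factor is constant and the coefficients cancel;
  beyond it both sides contain the vanishing \<open>Phi \<alpha> w\<close>.\<close>

lemma Phi_two_scale:
  assumes "0 < \<alpha>" and "\<alpha> < 1 / 3"
  shows "Phi \<alpha> w = 1 / sqrt 2 * (1 / sqrt pi) * (2 * pi * Phi \<alpha> w) * Phi \<alpha> (w / 2)"
proof (cases "\<bar>w\<bar> < (1 + \<alpha>) * pi")
  case True
  \<comment> \<open>The filter coefficient and the flat value each contribute
    \<open>1 / sqrt (2 * pi)\<close>; their product is what the factor \<open>2 * pi\<close>
    cancels.\<close>
  have "1 / sqrt 2 * (1 / sqrt pi) * (2 * pi * Phi \<alpha> w) * (1 / sqrt (2 * pi))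
      = 2 * pi * Phi \<alpha> w / (sqrt (2 * pi) * sqrt (2 * pi))"
    by (simp add: real_sqrt_mult)
  also have "\<dots> = Phi \<alpha> w"
    by simp
  finally show ?thesis
    by (simp only: Phi_half_eq[OF assms(2) True])
next
  case False
  then show ?thesis
    by (simp add: Phi_eq_0[OF assms(1)])
qed

text \<open>As \<open>w / 2\<close> ranges over all reals, the hypothesis determines
  \<open>H\<close> everywhere. The factor \<open>2 * pi\<close> in it and the value
  \<open>1 / sqrt (2 * pi)\<close> at the end are forced at \<open>w = 0\<close> by
  \<open>two_scale_without_factor_fails\<close> and \<open>Phi_zero_neq\<close>.\<close>

theorem mainTheorem2:
  fixes \<alpha> :: real and H :: "real \<Rightarrow> real"
  assumes "0 < \<alpha>" and "\<alpha> < 1 / 3"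
    and H: "\<And>w. H (w / 2) = 1 / sqrt pi * (2 * pi * Phi \<alpha> w)"
  shows "(\<forall>w. Phi \<alpha> w = 1 / sqrt 2 * H (w / 2) * Phi \<alpha> (w / 2)) \<and>
         (\<forall>w. Phi \<alpha> w = 1 / sqrt 2 * (1 / sqrt pi) * (2 * pi * Phi \<alpha> w) * Phi \<alpha> (w / 2)) \<and>
         (\<forall>w. \<bar>w\<bar> > (1 + \<alpha>) * pi \<longrightarrow>
            Phi \<alpha> w = 0 \<and> 1 / sqrt 2 * H (w / 2) * Phi \<alpha> (w / 2) = 0) \<and>
         (\<forall>w. \<bar>w\<bar> < (1 + \<alpha>) * pi \<longrightarrow> Phi \<alpha> (w / 2) = 1 / sqrt (2 * pi))"
proof (intro conjI allI impI)
  fix w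
  show two_scale: "Phi \<alpha> w = 1 / sqrt 2 * (1 / sqrt pi) * (2 * pi * Phi \<alpha> w) * Phi \<alpha> (w / 2)"
    by (rule Phi_two_scale[OF assms(1,2)])
  \<comment> \<open>Unfolding \<open>H\<close> turns this into the previous identity up to
    bracketing.\<close>
  then show "Phi \<alpha> w = 1 / sqrt 2 * H (w / 2) * Phi \<alpha> (w / 2)"
    by (simp only: H mult.assoc)
next
  fix w :: real
  assume "\<bar>w\<bar> > (1 + \<alpha>) * pi"
  then show "Phi \<alpha> w = 0"
    by (intro Phi_eq_0[OF assms(1)]) simp
  then show "1 / sqrt 2 * H (w / 2) * Phi \<alpha> (w / 2) = 0"
    by (simp add: H)
next
  fix w :: real
  assume "\<bar>w\<bar> < (1 + \<alpha>) * pi"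
  then show "Phi \<alpha> (w / 2) = 1 / sqrt (2 * pi)"
    by (rule Phi_half_eq[OF assms(2)])
qed

end
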